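(* A language $L \subseteq \Sigma^*$ is star-free if and only if it is $\mathrm{ADT}$-definable, i.e. if and only if there is an attack-defense tree $\theta\in\mathrm{ADT}$ with $[\![\theta]\!]=L$.
   Context: Fix a finite set $\mathrm{Prop}$ of propositions (with $\top := p\lor\neg p$ for $p\in\mathrm{Prop}$, and $\bot:=\neg\top$) and let $\Sigma = 2^{\mathrm{Prop}}$ be the alphabet of valuations. A trace is a word in $\Sigma^*$; $\varepsilon$ is the empty trace. The class of star-free languages over $\Sigma$ is the smallest class of languages containing the finite languages and closed under union, intersection, complement (in $\Sigma^*$) and concatenation. The set $\mathrm{ADT}$ of attack-defense trees is defined inductively: the special leaf $\epsilon$ and every propositional formula $\gamma$ over $\mathrm{Prop}$ are in $\mathrm{ADT}$; if $\theta_1,\dots,\theta_n\in\mathrm{ADT}$ then $\mathrm{OR}(\theta_1,\dots,\theta_n)$, $\mathrm{SAND}(\theta_1,\dots,\theta_n)$, $\mathrm{AND}(\theta_1,\dots,\theta_n)\in\mathrm{ADT}$; if $\theta,\theta'\in\mathrm{ADT}$ then $\mathrm{C}(\theta,\theta')\in\mathrm{ADT}$. Semantics $[\![\theta]\!]\subseteq\Sigma^*$: $[\![\epsilon]\!]=\{\varepsilon\}$; $[\![\gamma]\!]=\{v_1\cdots v_n\in\Sigma^* : n\ge 1,\ v_n\models\gamma\}$; $\mathrm{OR}$ is interpreted as union, $\mathrm{SAND}$ as concatenation (in the given order), $[\![\mathrm{C}(\theta_1,\theta_2)]\!]=[\![\theta_1]\!]\setminus[\![\theta_2]\!]$, and $[\![\mathrm{AND}(\theta_1,\dots,\theta_n)]\!]=\bigcup_{i}\big([\![\theta_i]\!]\cap\bigcap_{j\ne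 i}[\![\theta_j]\!]\cdot\Sigma^*\big)$. *)

theory Defs
  imports Main
begin

text \<open>
  The finite set of propositions is a type \<open>'p\<close> of class \<open>finite\<close>. It is nonempty, as the definition
  of \<open>\<top>\<close> by \<open>p \<or> \<not> p\<close> requires. A valuation is the set of propositions that it makes true, so the
  alphabet \<open>\<Sigma>\<close> is the whole type \<open>'p set\<close> and \<open>\<Sigma>\<^sup>*\<close> is \<open>UNIV :: 'p trace set\<close>.
\<close>

type_synonym 'p valuation = "'p set"
type_synonym 'p trace = "'p valuation list"

definition conc :: "'a list set \<Rightarrow> 'a list set \<Rightarrow> 'a list set" (infixr "@@" 75) where
  "A @@ B = {u @ v | u v. u \<in> A \<and> v \<in> B}"

inductive star_free :: "'a list set \<Rightarrow> bool" where
  star_free_finite: "finite L \<Longrightarrow> star_free L"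
| star_free_union: "star_free L \<Longrightarrow> star_free M \<Longrightarrow> star_free (L \<union> M)"
| star_free_inter: "star_free L \<Longrightarrow> star_free M \<Longrightarrow> star_free (L \<inter> M)"
| star_free_compl: "star_free L \<Longrightarrow> star_free (- L)"
| star_free_conc: "star_free L \<Longrightarrow> star_free M \<Longrightarrow> star_free (L @@ M)"

text \<open>
  The constants \<open>\<top>\<close> and \<open>\<bottom>\<close> are derived (\<open>p \<or> \<not> p\<close> and its negation), hence not constructors.
\<close>

datatype 'p form =
  Atom 'p
| Neg "'p form"
| Conj "'p form" "'p form"
| Disj "'p form" "'p form"

primrec models :: "'p valuation \<Rightarrow> 'p form \<Rightarrow> bool" where
  "models v (Atom p) \<longleftrightarrow> p \<in> v"
| "models v (Neg f) \<longleftrightarrow> \<not> models v f"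
| "models v (Conj f g) \<longleftrightarrow> models v f \<and> models v g"
| "models v (Disj f g) \<longleftrightarrow> models v f \<or> models v g"

text \<open>
  The datatype also contains trees with operators applied to no argument; the set \<open>ADT\<close> below
  excludes them.
\<close>

datatype 'p tree =
  Eps
| Leaf "'p form"
| Or "'p tree list"
| Sand "'p tree list"
| And "'p tree list"
| Counter "'p tree" "'p tree"

inductive_set ADT :: "'p tree set" where
  ADT_Eps: "Eps \<in> ADT"
| ADT_Leaf: "Leaf f \<in> ADT"
| ADT_Or: "ts \<noteq> [] \<Longrightarrow> \<forall>t \<in> set ts. t \<in> ADT \<Longrightarrow> Or ts \<in> ADT"
| ADT_Sand: "ts \<noteq> [] \<Longrightarrow> \<forall>t \<in> set ts. t \<in> ADT \<Longrightarrow> Sand ts \<in> ADT"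
| ADT_And: "ts \<noteq> [] \<Longrightarrow> \<forall>t \<in> set ts. t \<in> ADT \<Longrightarrow> And ts \<in> ADT"
| ADT_Counter: "t \<in> ADT \<Longrightarrow> t' \<in> ADT \<Longrightarrow> Counter t t' \<in> ADT"

text \<open>
  One argument is achieved by the whole trace, each of the others by some prefix of it. For a
  single argument the inner intersection is empty, that is, \<open>UNIV\<close>.
\<close>

definition and_lang :: "'a list set list \<Rightarrow> 'a list set" where
  "and_lang Ls =
    (\<Union>i \<in> {..<length Ls}. Ls ! i \<inter> (\<Inter>j \<in> {..<length Ls} - {i}. Ls ! j @@ UNIV))"

primrec sem :: "'p tree \<Rightarrow> 'p trace set" where
  "sem Eps = {[]}"
| "sem (Leaf f) = {w. w \<noteq> [] \<and> models (last w) f}"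
| "sem (Or ts) = \<Union> (set (map sem ts))"
| "sem (Sand ts) = foldr (@@) (map sem ts) {[]}"
| "sem (And ts) = and_lang (map sem ts)"
| "sem (Counter t t') = sem t - sem t'"

definition adt_definable :: "'p trace set \<Rightarrow> bool" where
  "adt_definable L \<longleftrightarrow> (\<exists>t \<in> ADT. sem t = L)"

end

theory Submission
  imports Defs
begin

text \<open>
  Since \<open>\<Sigma>\<close> is finite, \<open>\<lbrakk>\<gamma>\<rbrakk>\<close> is \<open>\<Sigma>\<^sup>*\<close> followed by a finite set of one-letter words, and the other
  operators are Boolean combinations and concatenations. Conversely, \<open>\<Sigma>\<^sup>*\<close> is definable as
  \<open>OR(\<epsilon>, \<top>)\<close>, so countermeasures give complements; and a one-letter word \<open>v\<close> is definable as the
  traces that end in \<open>v\<close> minus \<open>SAND(\<top>, \<top>)\<close>, the traces of length at least two.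
\<close>

lemma star_free_UNIV: "star_free UNIV"
  using star_free_compl[OF star_free_finite[OF finite.emptyI]] by simp

lemma star_free_diff: "star_free L \<Longrightarrow> star_free M \<Longrightarrow> star_free (L - M)"
  by (simp add: Diff_eq star_free_inter star_free_compl)

lemma star_free_UNION:
  "finite I \<Longrightarrow> (\<And>i. i \<in> I \<Longrightarrow> star_free (F i)) \<Longrightarrow> star_free (\<Union>i \<in> I. F i)"
  by (induction I rule: finite_induct) (auto intro: star_free_finite star_free_union)

text \<open>An empty index set yields \<open>UNIV\<close>; this case arises for
  \<open>and_lang\<close> with a single argument.\<close>

lemma star_free_INTER:
  "finite I \<Longrightarrow> (\<And>i. i \<in> I \<Longrightarrow> star_free (F i)) \<Longrightarrow> star_free (\<Inter>i \<in> I. F i)"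
  by (induction I rule: finite_induct) (auto intro: star_free_UNIV star_free_inter)

lemma star_free_foldr_conc:
  "(\<And>L. L \<in> set Ls \<Longrightarrow> star_free L) \<Longrightarrow> star_free (foldr (@@) Ls {[]})"
  by (induction Ls) (auto intro: star_free_finite star_free_conc)

lemma star_free_and_lang:
  "(\<And>L. L \<in> set Ls \<Longrightarrow> star_free L) \<Longrightarrow> star_free (and_lang Ls)"
  unfolding and_lang_def
  by (intro star_free_UNION star_free_inter star_free_INTER star_free_conc star_free_UNIV) auto

lemma star_free_last:
  fixes P :: "'a::finite \<Rightarrow> bool"
  shows "star_free {w. w \<noteq> [] \<and> P (last w)}"
proof -
  have "{w. w \<noteq> [] \<and> P (last w)} = UNIV @@ ((\<lambda>v. [v]) ` {v. P v})"
  proof (rule set_eqI)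
    fix w
    show "w \<in> {w. w \<noteq> [] \<and> P (last w)} \<longleftrightarrow> w \<in> UNIV @@ ((\<lambda>v. [v]) ` {v. P v})"
      by (cases w rule: rev_cases) (auto simp: conc_def)
  qed
  then show ?thesis
    by (simp add: star_free_conc star_free_UNIV star_free_finite)
qed

text \<open>The induction covers the whole datatype, including operators without arguments: an empty
  \<open>Or\<close> or \<open>And\<close> denotes the empty language, an empty \<open>Sand\<close>
  denotes \<open>{[]}\<close>.\<close>

lemma star_free_sem:
  fixes t :: "'p::finite tree"
  shows "star_free (sem t)"
proof (induction t)
  case (Or ts)
  then show ?case by (auto intro: star_free_UNION)
next
  case (Sand ts)
  then show ?case unfolding sem.simps by (intro star_free_foldr_conc) auto
next
  case (And ts)
  then show ?case unfolding sem.simps by (intro star_free_and_lang) auto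
qed (auto intro: star_free_finite star_free_last star_free_diff)

lemma adt_definable_sem: "t \<in> ADT \<Longrightarrow> adt_definable (sem t)"
  unfolding adt_definable_def by blast

lemma adt_definable_union:
  assumes "adt_definable L" "adt_definable M"
  shows "adt_definable (L \<union> M)"
proof -
  obtain s t where "s \<in> ADT" "sem s = L" "t \<in> ADT" "sem t = M"
    using assms unfolding adt_definable_def by blast
  then show ?thesis
    using adt_definable_sem[of "Or [s, t]"] by (simp add: ADT_Or)
qed

lemma adt_definable_conc:
  assumes "adt_definable L" "adt_definable M"
  shows "adt_definable (L @@ M)"
proof -
  obtain s t where "s \<in> ADT" "sem s = L" "t \<in> ADT" "sem t = M"
    using assms unfolding adt_definable_def by blast
  \<comment> \<open>The fold ends in \<open>{[]}\<close>, so the tree denotes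
    \<open>L @@ M @@ {[]}\<close>; unfolding \<open>conc_def\<close> removes this unit.\<close>
  then show ?thesis
    using adt_definable_sem[of "Sand [s, t]"] by (simp add: ADT_Sand conc_def)
qed

lemma adt_definable_diff:
  assumes "adt_definable L" "adt_definable M"
  shows "adt_definable (L - M)"
proof -
  obtain s t where "s \<in> ADT" "sem s = L" "t \<in> ADT" "sem t = M"
    using assms unfolding adt_definable_def by blast
  then show ?thesis
    using adt_definable_sem[of "Counter s t"] by (simp add: ADT_Counter)
qed

lemma adt_definable_Eps: "adt_definable {[]}"
  using adt_definable_sem[OF ADT_Eps] by simp

lemma adt_definable_empty: "adt_definable {}"
  using adt_definable_diff[OF adt_definable_Eps adt_definable_Eps] by simp

lemma adt_definable_nonempty: "adt_definable {w. w \<noteq> []}"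
  \<comment> \<open>\<open>p\<close> stands for an arbitrary proposition, which exists because types
    are inhabited.\<close>
  using adt_definable_sem[OF ADT_Leaf[of "Disj (Atom p) (Neg (Atom p))"]] by simp

lemma adt_definable_UNIV: "adt_definable UNIV"
proof -
  have "adt_definable ({[]} \<union> {w. w \<noteq> []})"
    by (intro adt_definable_union adt_definable_Eps adt_definable_nonempty)
  also have "{[]} \<union> {w :: 'a trace. w \<noteq> []} = UNIV" by auto
  finally show ?thesis .
qed

lemma adt_definable_compl: "adt_definable L \<Longrightarrow> adt_definable (- L)"
  by (simp add: Compl_eq_Diff_UNIV adt_definable_diff adt_definable_UNIV)

text \<open>\<open>And\<close> does not serve directly, since it asks only for a prefix in all but
  one argument; a countermeasure against the complement of \<open>M\<close> does.\<close>

lemma adt_definable_inter: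
  assumes "adt_definable L" "adt_definable M"
  shows "adt_definable (L \<inter> M)"
  using adt_definable_diff[OF assms(1) adt_definable_compl[OF assms(2)]] by (simp add: Diff_eq)

text \<open>Conjoin, over the finitely many propositions, the literal that holds in
  \<open>v\<close>.\<close>

lemma characteristic_form:
  fixes v :: "'p::finite valuation"
  obtains f where "\<And>u. models u f \<longleftrightarrow> u = v"
proof -
  \<comment> \<open>Agreement on a set \<open>S\<close> allows induction on \<open>S\<close>;
    agreement on \<open>UNIV\<close> is equality with \<open>v\<close>.\<close>
  have "\<exists>f. \<forall>u. models u f \<longleftrightarrow> (\<forall>p \<in> S. p \<in> u \<longleftrightarrow> p \<in> v)" for S
  proof (induction S rule: finite_induct[OF finite])
    \<comment> \<open>The empty conjunction is a tautology.\<close>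
    case 1
    have "\<forall>u. models u (Disj (Atom p) (Neg (Atom p)))" for p :: 'p
      by simp
    then show ?case by blast
  next
    case (2 p S)
    then obtain f where f: "\<And>u. models u f \<longleftrightarrow> (\<forall>p \<in> S. p \<in> u \<longleftrightarrow> p \<in> v)"
      by blast
    define g where "g = Conj (if p \<in> v then Atom p else Neg (Atom p)) f"
    have "\<forall>u. models u g \<longleftrightarrow> (\<forall>p \<in> insert p S. p \<in> u \<longleftrightarrow> p \<in> v)"
      by (simp add: g_def f)
    then show ?case by blast
  qed
  from this[of UNIV] that show thesis by (auto simp: set_eq_iff)
qed

lemma adt_definable_letter:
  fixes v :: "'p::finite valuation"
  shows "adt_definable {[v]}"
proof -
  obtain f where f: "\<And>u. models u f \<longleftrightarrow> u = v"
    using characteristic_form by blast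
  have "{[v]} = sem (Leaf f) - {w. w \<noteq> []} @@ {w. w \<noteq> []}"
  proof (rule set_eqI)
    fix w
    show "w \<in> {[v]} \<longleftrightarrow> w \<in> sem (Leaf f) - {w. w \<noteq> []} @@ {w. w \<noteq> []}"
      \<comment> \<open>For \<open>w = xs @ [x]\<close>, a nonempty \<open>xs\<close> puts
        \<open>w\<close> into the subtracted concatenation; otherwise \<open>w = [x]\<close>, and
        \<open>f\<close> forces \<open>x = v\<close>.\<close>
      by (cases w rule: rev_cases) (auto simp: conc_def f Cons_eq_append_conv append_eq_Cons_conv)
  qed
  then show ?thesis
    using adt_definable_diff[OF adt_definable_sem[OF ADT_Leaf]
        adt_definable_conc[OF adt_definable_nonempty adt_definable_nonempty]]
    by metis
qed

lemma adt_definable_word: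
  fixes w :: "'p::finite trace"
  shows "adt_definable {w}"
proof (induction w)
  case Nil
  show ?case by (rule adt_definable_Eps)
next
  case (Cons v w)
  have "{v # w} = {[v]} @@ {w}" by (auto simp: conc_def)
  then show ?case
    using adt_definable_conc[OF adt_definable_letter Cons.IH] by simp
qed

lemma adt_definable_finite:
  fixes L :: "'p::finite trace set"
  assumes "finite L"
  shows "adt_definable L"
  using assms
proof (induction L rule: finite_induct)
  case empty
  show ?case by (rule adt_definable_empty)
next
  case (insert w L)
  then show ?case
    using adt_definable_union[OF adt_definable_word[of w]] by simp
qed

theorem theorem2:
  fixes L :: "'p::finite trace set"
  shows "star_free L \<longleftrightarrow> adt_definable L"
proof
  \<comment> \<open>Rule induction: each clause of \<open>star_free\<close> has its counterpart
    among the properties of definable languages.\<close>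
  show "adt_definable L" if "star_free L"
    using that
    by induction (auto intro: adt_definable_finite adt_definable_union adt_definable_inter
        adt_definable_compl adt_definable_conc)
  show "star_free L" if "adt_definable L"
    using that star_free_sem unfolding adt_definable_def by blast
qed

end
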